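(* Let $X=c_0$ or $X=\ell^p$ with $1\le p<+\infty$ (sequences indexed by $\mathbb N_0$), let $I\subset\mathbb R$ and $d\in\mathbb N$. Consider an admissible family of weights $(w(x))_{x\in I}$ such that there are $F:\mathbb N\to(0,+\infty)$ and $c>0$ satisfying $$|f_n(x)-f_n(y)|\ge cF(n)|x-y|$$ for all $x,y\in I$ and $n\in\mathbb N$, where $f_n(x)=\sum_{k=1}^n\log(|w_k(x)|)$. If for some $s>0$ we have $\sum_{n\in\mathbb N}1/F(n)^s<+\infty$, then, for any $\Lambda\subset I^d$ with positive $s$-dimensional Hausdorff outer measure, we have $$\bigcap_{\lambda\in\Lambda}HC\big(B_{w(\lambda(1))}\times\cdots\times B_{w(\lambda(d))}\big)=\varnothing .$$
   Context: For a sequence $w=(w_n)_{n\in\mathbb N}$ of non-zero scalars (a weight), the weighted backward shift is $B_w(x_0,x_1,x_2,\dots)=(w_1x_1,w_2x_2,w_3x_3,\dots)$; $w$ is admissible if $B_w:X\to X$ is bounded. An admissible family of weights $(w(x))_{x\in I}$ is a family of admissible weights $w(x)=(w_n(x))_{n\in\mathbb N}$ inducing a continuous family of shifts, i.e. $(u,x)\mapsto B_{w(x)}^nu$ is continuous from $X\times I$ to $X$ for all $n$. Points $\lambda\in I^d$ are written $\lambda=(\lambda(1),\dots,\lambda(d))$. The product $B_{w(\lambda(1))}\times\cdots\times B_{w(\lambda(d))}$ acts coordinatewise on $X^d$. For an operator $T$ on a space $Y$, $HC(T)$ is the set of $u\in Y$ whose orbit $\{T^nu:n\in\mathbb N_0\}$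 is dense in $Y$. The $s$-dimensional Hausdorff outer measure of $\Lambda\subset\mathbb R^d$ is $\lim_{\varepsilon\to0}\inf_R\sum_{B\in R}\mathrm{diam}(B)^s$, the infimum being over countable coverings $R$ of $\Lambda$ by balls $B$ of diameter at most $\varepsilon$; $\mathbb R^d$ carries the sup norm. *)

theory Defs
  imports "HOL-Analysis.Analysis"
begin

text \<open>
  The scalar field is a type of class \<^class>\<open>real_normed_field\<close>; up to isometric isomorphism these
  are exactly the real and the complex numbers.  A sequence space is a carrier set of
  sequences indexed by the natural numbers starting at 0, together with a norm that is
  meaningful on that carrier only.
\<close>

definition c0_space :: "(nat \<Rightarrow> 'a::real_normed_field) set" where
  "c0_space = {u. u \<longlonglongrightarrow> 0}"

definition c0_norm :: "(nat \<Rightarrow> 'a::real_normed_field) \<Rightarrow> real" where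
  "c0_norm u = (SUP n. norm (u n))"

definition lp_space :: "real \<Rightarrow> (nat \<Rightarrow> 'a::real_normed_field) set" where
  "lp_space p = {u. summable (\<lambda>n. norm (u n) powr p)}"

definition lp_norm :: "real \<Rightarrow> (nat \<Rightarrow> 'a::real_normed_field) \<Rightarrow> real" where
  "lp_norm p u = (\<Sum>n. norm (u n) powr p) powr (1 / p)"

text \<open>
  The guard in the distance is needed because the locale \<^locale>\<open>Metric_space\<close> asks for a
  nonnegative distance also off the carrier, where \<^const>\<open>c0_norm\<close> may be the unspecified
  supremum of an unbounded set.
\<close>

definition seq_dist ::
  "(nat \<Rightarrow> 'a::real_normed_field) set \<Rightarrow> ((nat \<Rightarrow> 'a) \<Rightarrow> real) \<Rightarrow> (nat \<Rightarrow> 'a) \<Rightarrow> (nat \<Rightarrow> 'a) \<Rightarrow> real"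
  where
  "seq_dist X nrm u v = (if u \<in> X \<and> v \<in> X then nrm (\<lambda>n. u n - v n) else 0)"

definition seq_topology ::
  "(nat \<Rightarrow> 'a::real_normed_field) set \<Rightarrow> ((nat \<Rightarrow> 'a) \<Rightarrow> real) \<Rightarrow> (nat \<Rightarrow> 'a) topology" where
  "seq_topology X nrm = Metric_space.mtopology X (seq_dist X nrm)"

text \<open>Weights are indexed from 1 on: the entry with index 0 is never used.\<close>

definition bshift :: "(nat \<Rightarrow> 'a::real_normed_field) \<Rightarrow> (nat \<Rightarrow> 'a) \<Rightarrow> (nat \<Rightarrow> 'a)" where
  "bshift w u = (\<lambda>n. w (Suc n) * u (Suc n))"

definition admissible_weight ::
  "(nat \<Rightarrow> 'a::real_normed_field) set \<Rightarrow> ((nat \<Rightarrow> 'a) \<Rightarrow> real) \<Rightarrow> (nat \<Rightarrow> 'a) \<Rightarrow> bool" where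
  "admissible_weight X nrm w \<longleftrightarrow>
     (\<forall>n\<ge>1. w n \<noteq> 0) \<and>
     (\<forall>u\<in>X. bshift w u \<in> X) \<and>
     (\<exists>C. \<forall>u\<in>X. nrm (bshift w u) \<le> C * nrm u)"

definition admissible_family ::
  "(nat \<Rightarrow> 'a::real_normed_field) set \<Rightarrow> ((nat \<Rightarrow> 'a) \<Rightarrow> real) \<Rightarrow> real set \<Rightarrow> (real \<Rightarrow> nat \<Rightarrow> 'a) \<Rightarrow> bool"
  where
  "admissible_family X nrm I w \<longleftrightarrow>
     (\<forall>x\<in>I. admissible_weight X nrm (w x)) \<and>
     (\<forall>n\<ge>1. continuous_map (prod_topology (seq_topology X nrm) (top_of_set I)) (seq_topology X nrm)
              (\<lambda>(u, x). (bshift (w x) ^^ n) u))"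

definition HC :: "'b topology \<Rightarrow> ('b \<Rightarrow> 'b) \<Rightarrow> 'b set" where
  "HC Y T = {u \<in> topspace Y. Y closure_of (range (\<lambda>n. (T ^^ n) u)) = topspace Y}"

text \<open>
  The power \<open>X\<^sup>d\<close> consists of the functions from a finite index type of cardinality \<open>d\<close>
  into \<open>X\<close>, with the product topology.
\<close>

definition power_topology :: "'b topology \<Rightarrow> ('d::finite \<Rightarrow> 'b) topology" where
  "power_topology Y = product_topology (\<lambda>_. Y) UNIV"

definition product_bshift ::
  "(real \<Rightarrow> nat \<Rightarrow> 'a::real_normed_field) \<Rightarrow> real ^ 'd::finite \<Rightarrow> ('d \<Rightarrow> nat \<Rightarrow> 'a) \<Rightarrow> ('d \<Rightarrow> nat \<Rightarrow> 'a)"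
  where
  "product_bshift w \<mu> u = (\<lambda>i. bshift (w (\<mu> $ i)) (u i))"

text \<open>
  Balls and diameters are those of the sup norm \<^const>\<open>infnorm\<close>, not of the Euclidean norm.
  Balls are closed with positive radius; open balls give the same limit below.
\<close>

definition sup_balls :: "(real ^ 'd::finite) set set" where
  "sup_balls = {{y. infnorm (y - a) \<le> r} | a r. r > 0}"

definition sup_diam :: "(real ^ 'd::finite) set \<Rightarrow> real" where
  "sup_diam B = Sup {infnorm (x - y) | x y. x \<in> B \<and> y \<in> B}"

definition hausdorff_pre :: "real \<Rightarrow> real \<Rightarrow> (real ^ 'd::finite) set \<Rightarrow> ennreal" where
  "hausdorff_pre s \<epsilon> \<Lambda> =
     (INF R \<in> {R. countable R \<and> R \<subseteq> sup_balls \<and> (\<forall>B\<in>R. sup_diam B \<le> \<epsilon>) \<and> \<Lambda> \<subseteq> \<Union>R}.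
        (\<Sum>\<^sub>\<infinity>B\<in>R. ennreal (sup_diam B powr s)))"

definition hausdorff_outer_measure :: "real \<Rightarrow> (real ^ 'd::finite) set \<Rightarrow> ennreal" where
  "hausdorff_outer_measure s \<Lambda> = Lim (at_right 0) (\<lambda>\<epsilon>. hausdorff_pre s \<epsilon> \<Lambda>)"

end

theory Submission
  imports Defs
begin

text \<open>
  Suppose that \<open>u\<close> is hypercyclic for the product of shifts at every parameter \<open>\<mu> \<in> \<Lambda>\<close>.  The
  first coordinate of the \<open>n\<close>-th iterate of \<open>u i\<close> has modulus \<open>exp (f n (\<mu> $ i)) * norm (u i n)\<close>.
  By hypercyclicity, all these first coordinates are simultaneously within 1/2 of 1 for
  infinitely many \<open>n\<close> (\<open>HC_visits_infinitely_often\<close>).  If this happens for two parameters \<open>\<mu>\<close> and \<open>\<nu>\<close> at the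
  same time \<open>n\<close>, then the unknown factor \<open>norm (u i n)\<close> cancels in the quotient, so that \<open>f n (\<mu> $ i)\<close>
  and \<open>f n (\<nu> $ i)\<close> differ by less than \<open>ln 3\<close> (\<open>abs_diff_less_ln3\<close>), and the
  separation hypothesis puts \<open>\<mu>\<close> and \<open>\<nu>\<close> at sup distance at most \<open>ln 3 / (c * F n)\<close>.

  Hence \<open>\<Lambda>\<close> is contained in the limsup of sets \<open>A n\<close> whose diameters have summable \<open>s\<close>-th powers.
  Covering \<open>\<Lambda>\<close> by the tails of this family shows that its \<open>s\<close>-dimensional Hausdorff outer measure is 0
  (\<open>hausdorff_outer_measure_limsup_eq_0\<close>), against the hypothesis.

  To speak of open sets, the distances on \<open>c\<^sub>0\<close> and \<open>\<ell>\<^sup>p\<close> must be shown to be metrics; for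
  \<open>\<ell>\<^sup>p\<close> this is Minkowski's inequality for series (\<open>lp_add\<close>).
\<close>

section \<open>Sequence spaces with coordinates dominated by the norm\<close>

text \<open>
  This collects what \<open>c\<^sub>0\<close> and \<open>\<ell>\<^sup>p\<close> have in common and what makes the visiting-time argument work:
  coordinates are controlled by the norm, so that conditions on the first coordinates define
  open sets, and the multiples of the first unit vector make these sets nonempty.
\<close>

locale coordinatewise_normed_space =
  fixes X :: "(nat \<Rightarrow> 'a::real_normed_field) set" and nrm :: "(nat \<Rightarrow> 'a) \<Rightarrow> real"
  assumes diff_mem: "u \<in> X \<Longrightarrow> v \<in> X \<Longrightarrow> (\<lambda>n. u n - v n) \<in> X"
    and coordinate_le: "u \<in> X \<Longrightarrow> norm (u n) \<le> nrm u"
    and nrm_zero: "nrm (\<lambda>_. 0) = 0"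
    and nrm_minus_commute: "nrm (\<lambda>n. u n - v n) = nrm (\<lambda>n. v n - u n)"
    and nrm_triangle: "u \<in> X \<Longrightarrow> v \<in> X \<Longrightarrow> nrm (\<lambda>n. u n + v n) \<le> nrm u + nrm v"
    and first_unit_mem: "(\<lambda>n. if n = 0 then t else 0) \<in> X"
begin

lemma Metric_space_seq_dist: "Metric_space X (seq_dist X nrm)"
proof
  show "0 \<le> seq_dist X nrm u v" for u v
    using coordinate_le[OF diff_mem, of u v 0] by (auto simp: seq_dist_def intro: order_trans[OF norm_ge_zero])
  show "seq_dist X nrm u v = seq_dist X nrm v u" for u v
    by (simp add: seq_dist_def nrm_minus_commute[of u v])
  show "seq_dist X nrm u v = 0 \<longleftrightarrow> u = v" if "u \<in> X" "v \<in> X" for u v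
  proof
    assume "seq_dist X nrm u v = 0"
    then have "norm (u n - v n) \<le> 0" for n
      using coordinate_le[OF diff_mem[OF that], of n] that by (simp add: seq_dist_def)
    then show "u = v" by auto
  qed (use that in \<open>simp add: seq_dist_def nrm_zero\<close>)
  show "seq_dist X nrm u x \<le> seq_dist X nrm u v + seq_dist X nrm v x"
    if "u \<in> X" "v \<in> X" "x \<in> X" for u v x
    using nrm_triangle[OF diff_mem[OF that(1,2)] diff_mem[OF that(2,3)]] that
    by (simp add: seq_dist_def)
qed

lemma topspace_seq_topology: "topspace (seq_topology X nrm) = X"
  unfolding seq_topology_def by (rule Metric_space.topspace_mtopology[OF Metric_space_seq_dist])

lemma openin_coordinate_preimage:
  assumes "open G"
  shows "openin (seq_topology X nrm) {v \<in> X. v n \<in> G}"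
  unfolding seq_topology_def Metric_space.openin_mtopology[OF Metric_space_seq_dist]
proof safe
  fix v assume v: "v \<in> X" "v n \<in> G"
  obtain e where e: "e > 0" "\<And>z. dist z (v n) < e \<Longrightarrow> z \<in> G"
    using assms v(2) by (meson open_dist)
  have "x \<in> {v \<in> X. v n \<in> G}" if "x \<in> Metric_space.mball X (seq_dist X nrm) v e" for x
  proof -
    have x: "x \<in> X" "seq_dist X nrm v x < e"
      using that by (simp_all add: Metric_space.in_mball[OF Metric_space_seq_dist])
    have "norm (v n - x n) < e"
      using coordinate_le[OF diff_mem[OF v(1) x(1)], of n] x v by (simp add: seq_dist_def)
    then show ?thesis using x e(2) by (simp add: dist_norm norm_minus_commute)
  qed
  then show "\<exists>r>0. Metric_space.mball X (seq_dist X nrm) v r \<subseteq> {v \<in> X. v n \<in> G}"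
    using e(1) by blast
qed

text \<open>
  Only the first coordinates matter: requiring all of them to be near 1 defines a nonempty open
  set, which the dense orbit meets.  That it does so at arbitrarily late times needs an
  argument, because density alone provides a single visit.  The finitely many values taken by
  the first coordinates before time \<open>N\<close> are deleted from the neighbourhood of 1; it stays open
  and nonempty, and a visit to what remains must happen at time \<open>N\<close> or later.
\<close>

lemma HC_visits_infinitely_often:
  fixes u :: "'d::finite \<Rightarrow> nat \<Rightarrow> 'a"
  assumes "u \<in> HC (power_topology (seq_topology X nrm)) T"
  shows "\<exists>n\<ge>N. \<forall>i. norm ((T ^^ n) u i 0 - 1) < 1 / 2"
proof -
  let ?Y = "power_topology (seq_topology X nrm) :: ('d \<Rightarrow> nat \<Rightarrow> 'a) topology"
  define S where "S = (\<lambda>(n, i). (T ^^ n) u i 0) ` ({..<N} \<times> UNIV)"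
  define G where "G = ball 1 (1 / 2) - S"
  define U where "U = (\<Pi>\<^sub>E i\<in>(UNIV::'d set). {v \<in> X. v 0 \<in> G})"
  have fin: "finite S" by (simp add: S_def)
  then have "open G" by (simp add: G_def open_Diff finite_imp_closed)
  then have "openin ?Y U"
    unfolding U_def power_topology_def
    by (simp add: openin_PiE openin_coordinate_preimage)
  have "(of_real ` {1..<3 / 2} :: 'a set) \<subseteq> ball 1 (1 / 2)"
  proof
    fix z :: 'a assume "z \<in> of_real ` {1..<3 / 2}"
    then obtain t where t: "z = of_real t" "1 \<le> t" "t < 3 / 2" by auto
    then have "dist 1 z = \<bar>1 - t\<bar>"
      by (metis dist_norm norm_of_real of_real_1 of_real_diff)
    then show "z \<in> ball 1 (1 / 2)" using t by simp
  qed
  moreover have "infinite (of_real ` {1::real..<3 / 2} :: 'a set)"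
    by (subst finite_image_iff) (auto simp: inj_on_def)
  ultimately have "infinite (ball (1::'a) (1 / 2))" using finite_subset by blast
  then obtain z where z: "z \<in> G"
    using fin by (metis G_def Diff_eq_empty_iff all_not_in_conv finite_subset)
  define v :: "'d \<Rightarrow> nat \<Rightarrow> 'a" where "v = (\<lambda>_ n. if n = 0 then z else 0)"
  have "v \<in> U" using z first_unit_mem by (auto simp: v_def U_def)
  moreover from this have "v \<in> topspace ?Y"
    using openin_subset[OF \<open>openin ?Y U\<close>] by blast
  ultimately obtain n where n: "(T ^^ n) u \<in> U"
    using assms \<open>openin ?Y U\<close> unfolding HC_def by (auto simp: set_eq_iff in_closure_of)
  then have G: "(T ^^ n) u i 0 \<in> G" for i by (auto simp: U_def)
  moreover have "n \<ge> N"
    using G[of undefined] by (force simp: G_def S_def)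
  ultimately show ?thesis
    by (auto simp: G_def dist_norm norm_minus_commute)
qed

end

section \<open>The spaces \<open>c\<^sub>0\<close> and \<open>\<ell>\<^sup>p\<close>\<close>

lemma coordinatewise_normed_space_c0:
  "coordinatewise_normed_space (c0_space :: (nat \<Rightarrow> 'a::real_normed_field) set) c0_norm"
proof
  have bdd: "bdd_above (range (\<lambda>n. norm (u n)))" if "u \<in> c0_space" for u :: "nat \<Rightarrow> 'a"
    using that by (auto simp: c0_space_def bounded_imp_bdd_above bounded_norm_comp
      dest!: convergent_imp_bounded intro: bounded_imp_bdd_above)
  fix u v :: "nat \<Rightarrow> 'a" and n :: nat and t :: 'a
  show "norm (u n) \<le> c0_norm u" if "u \<in> c0_space"
    unfolding c0_norm_def by (rule cSUP_upper[OF UNIV_I bdd[OF that]])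
  show "(\<lambda>n. u n - v n) \<in> c0_space" if "u \<in> c0_space" "v \<in> c0_space"
    using that tendsto_diff[of u 0 sequentially v 0] by (simp add: c0_space_def)
  show "c0_norm (\<lambda>_. 0 :: 'a) = 0" by (simp add: c0_norm_def)
  show "c0_norm (\<lambda>n. u n - v n) = c0_norm (\<lambda>n. v n - u n)"
    by (simp add: c0_norm_def norm_minus_commute)
  show "c0_norm (\<lambda>n. u n + v n) \<le> c0_norm u + c0_norm v" if "u \<in> c0_space" "v \<in> c0_space"
    unfolding c0_norm_def
  proof (rule cSUP_least)
    show "norm (u n + v n) \<le> (SUP n. norm (u n)) + (SUP n. norm (v n))" for n
      using cSUP_upper[OF UNIV_I bdd[OF that(1)], of n] cSUP_upper[OF UNIV_I bdd[OF that(2)], of n]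
        norm_triangle_ineq[of "u n" "v n"] by linarith
  qed simp
  show "(\<lambda>n. if n = 0 then t else 0) \<in> c0_space"
    unfolding c0_space_def
    by (auto intro!: tendsto_eventually simp: eventually_sequentially intro: exI[of _ 1])
qed

text \<open>
  Convexity of the power function on the closed half-line.  When one of the points is 0, the
  claim amounts to \<open>d powr p \<le> d\<close> for the weight \<open>d \<le> 1\<close> of the other point.
\<close>

lemma powr_convex_combination_le:
  fixes x y a b p :: real
  assumes "x \<ge> 0" "y \<ge> 0" "a > 0" "b > 0" "a + b = 1" "p \<ge> 1"
  shows "(a * x + b * y) powr p \<le> a * x powr p + b * y powr p"
proof -
  have scaled: "(d * z) powr p \<le> d * z powr p" if "0 < d" "d \<le> 1" "z \<ge> 0" for d z :: real
    using that assms(6) powr_le1 powr_mono'[of 1 p d]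
    by (simp add: powr_mult mult_right_mono)
  consider "x = 0" | "y = 0" | "x > 0" "y > 0" using assms by linarith
  then show ?thesis
  proof cases
    case 3
    have a: "a = 1 - b" using assms by simp
    with 3 show ?thesis
      using convex_onD[OF powr_convex[OF assms(6)], of b x y] assms
      unfolding a by simp
  qed (use assms scaled[of b y] scaled[of a x] in auto)
qed

text \<open>
  The heart of Minkowski's inequality.  With \<open>a\<close> and \<open>b\<close> as upper bounds for the \<open>p\<close>-norms,
  \<open>(f + g) / (a + b)\<close> is the convex combination of \<open>f / a\<close> and \<open>g / b\<close> with weights \<open>a / (a + b)\<close>
  and \<open>b / (a + b)\<close>, and these two sequences have \<open>p\<close>-norm at most 1.  Working with
  positive upper bounds rather than with the norms themselves avoids dividing by a zero norm.
\<close>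

lemma powr_add_sums_le:
  fixes f g :: "nat \<Rightarrow> real"
  assumes p: "p \<ge> 1" and nn: "\<And>n. f n \<ge> 0" "\<And>n. g n \<ge> 0" and a: "a > 0" "b > 0"
    and f: "summable (\<lambda>n. f n powr p)" "(\<Sum>n. f n powr p) \<le> a powr p"
    and g: "summable (\<lambda>n. g n powr p)" "(\<Sum>n. g n powr p) \<le> b powr p"
  shows "summable (\<lambda>n. (f n + g n) powr p)" "(\<Sum>n. (f n + g n) powr p) \<le> (a + b) powr p"
proof -
  define h where "h n = (a + b) powr p *
    (a / (a + b) / a powr p * (f n powr p) + b / (a + b) / b powr p * (g n powr p))" for n
  have le: "(f n + g n) powr p \<le> h n" for n
  proof -
    have "f n + g n = (a + b) * (a / (a + b) * (f n / a) + b / (a + b) * (g n / b))"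
      using a by (simp add: distrib_left)
    also have "\<dots> powr p = (a + b) powr p * (a / (a + b) * (f n / a) + b / (a + b) * (g n / b)) powr p"
      by (rule powr_mult)
    also have "(a / (a + b) * (f n / a) + b / (a + b) * (g n / b)) powr p
        \<le> a / (a + b) * (f n / a) powr p + b / (a + b) * (g n / b) powr p"
      using a nn p by (intro powr_convex_combination_le) (simp_all add: add_divide_distrib[symmetric])
    also have "(f n / a) powr p = f n powr p / a powr p" using a nn by (simp add: powr_divide)
    also have "(g n / b) powr p = g n powr p / b powr p" using a nn by (simp add: powr_divide)
    finally show ?thesis using a by (simp add: h_def mult_left_mono)
  qed
  have sh: "summable h"
    unfolding h_def using f(1) g(1) by (intro summable_mult summable_add)
  show sm: "summable (\<lambda>n. (f n + g n) powr p)"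
    by (rule summable_comparison_test'[OF sh, of 0]) (use le in simp)
  have "(\<Sum>n. (f n + g n) powr p) \<le> suminf h"
    by (rule suminf_le[OF le sm sh])
  also have "suminf h = (a + b) powr p * (a / (a + b) / a powr p * (\<Sum>n. f n powr p)
      + b / (a + b) / b powr p * (\<Sum>n. g n powr p))"
    unfolding h_def using f(1) g(1)
    by (intro sums_unique[symmetric] sums_mult sums_add summable_sums)
  also have "\<dots> \<le> (a + b) powr p * (a / (a + b) / a powr p * a powr p
      + b / (a + b) / b powr p * b powr p)"
    using a f(2) g(2) by (intro mult_left_mono add_mono) auto
  also have "\<dots> = (a + b) powr p"
    using a by (simp add: add_divide_distrib[symmetric])
  finally show "(\<Sum>n. (f n + g n) powr p) \<le> (a + b) powr p" .
qed

lemma lp_norm_ge_0: "lp_norm p u \<ge> 0" by (simp add: lp_norm_def)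

lemma suminf_powr_eq_lp_norm_powr:
  assumes "p \<ge> 1" "u \<in> lp_space p"
  shows "(\<Sum>n. norm (u n) powr p) = lp_norm p u powr p"
  using assms by (simp add: lp_norm_def lp_space_def powr_powr suminf_nonneg)

lemma lp_add:
  fixes u v :: "nat \<Rightarrow> 'a::real_normed_field"
  assumes p: "p \<ge> 1" and u: "u \<in> lp_space p" and v: "v \<in> lp_space p"
  shows "(\<lambda>n. u n + v n) \<in> lp_space p"
    and "lp_norm p (\<lambda>n. u n + v n) \<le> lp_norm p u + lp_norm p v"
proof -
  have *: "summable (\<lambda>n. norm (u n + v n) powr p) \<and>
     lp_norm p (\<lambda>n. u n + v n) \<le> (lp_norm p u + e) + (lp_norm p v + e)" if e: "e > 0" for e
  proof -
    let ?a = "lp_norm p u + e" and ?b = "lp_norm p v + e"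
    have pos: "?a > 0" "?b > 0" using e lp_norm_ge_0[of p u] lp_norm_ge_0[of p v] by linarith+
    have su: "summable (\<lambda>n. norm (u n) powr p)" "(\<Sum>n. norm (u n) powr p) \<le> ?a powr p"
      using u p e by (simp_all add: lp_space_def suminf_powr_eq_lp_norm_powr powr_mono2 lp_norm_ge_0)
    have sv: "summable (\<lambda>n. norm (v n) powr p)" "(\<Sum>n. norm (v n) powr p) \<le> ?b powr p"
      using v p e by (simp_all add: lp_space_def suminf_powr_eq_lp_norm_powr powr_mono2 lp_norm_ge_0)
    note M = powr_add_sums_le[OF p norm_ge_zero norm_ge_zero pos su sv]
    have le: "norm (u n + v n) powr p \<le> (norm (u n) + norm (v n)) powr p" for n
      using p by (intro powr_mono2 norm_triangle_ineq) auto
    have sm: "summable (\<lambda>n. norm (u n + v n) powr p)"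
      by (rule summable_comparison_test'[OF M(1), of 0]) (use le in simp)
    have "(\<Sum>n. norm (u n + v n) powr p) \<le> (?a + ?b) powr p"
      using suminf_le[OF le sm M(1)] M(2) by linarith
    then have "lp_norm p (\<lambda>n. u n + v n) \<le> ((?a + ?b) powr p) powr (1 / p)"
      unfolding lp_norm_def[of p "\<lambda>n. u n + v n"]
      using p by (intro powr_mono2 suminf_nonneg sm) auto
    also have "\<dots> = ?a + ?b" using p pos by (simp add: powr_powr)
    finally show ?thesis using sm by blast
  qed
  show "(\<lambda>n. u n + v n) \<in> lp_space p" using *[of 1] by (simp add: lp_space_def)
  show "lp_norm p (\<lambda>n. u n + v n) \<le> lp_norm p u + lp_norm p v"
  proof (rule field_le_epsilon)
    show "lp_norm p (\<lambda>n. u n + v n) \<le> lp_norm p u + lp_norm p v + e" if "e > 0" for e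
      using *[of "e / 2"] that by simp
  qed
qed

lemma coordinatewise_normed_space_lp:
  assumes p: "p \<ge> 1"
  shows "coordinatewise_normed_space (lp_space p :: (nat \<Rightarrow> 'a::real_normed_field) set) (lp_norm p)"
proof
  fix u v :: "nat \<Rightarrow> 'a" and n :: nat and t :: 'a
  show "norm (u n) \<le> lp_norm p u" if "u \<in> lp_space p"
  proof -
    have "norm (u n) = (\<Sum>k\<in>{n}. norm (u k) powr p) powr (1 / p)"
      using p by (simp add: powr_powr)
    also have "\<dots> \<le> lp_norm p u"
      unfolding lp_norm_def using p that
      by (intro powr_mono2 sum_le_suminf) (auto simp: lp_space_def)
    finally show ?thesis .
  qed
  show "(\<lambda>n. u n - v n) \<in> lp_space p" if "u \<in> lp_space p" "v \<in> lp_space p"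
    using lp_add(1)[OF p that(1), of "\<lambda>n. - v n"] that(2) by (simp add: lp_space_def)
  show "lp_norm p (\<lambda>_. 0 :: 'a) = 0" by (simp add: lp_norm_def)
  show "lp_norm p (\<lambda>n. u n - v n) = lp_norm p (\<lambda>n. v n - u n)"
    by (simp add: lp_norm_def norm_minus_commute)
  show "lp_norm p (\<lambda>n. u n + v n) \<le> lp_norm p u + lp_norm p v"
    if "u \<in> lp_space p" "v \<in> lp_space p"
    by (rule lp_add(2)[OF p that])
  show "(\<lambda>n. if n = 0 then t else 0) \<in> lp_space p"
    unfolding lp_space_def by (auto intro!: summable_finite[of "{0}"] split: if_splits)
qed

section \<open>Limsup sets of summable size are Hausdorff null\<close>

lemma sup_diam_ball_bounds:
  fixes a :: "real ^ 'd::finite"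
  assumes "r > 0"
  shows "0 \<le> sup_diam {y. infnorm (y - a) \<le> r}" "sup_diam {y. infnorm (y - a) \<le> r} \<le> 2 * r"
proof -
  let ?D = "{infnorm (x - y) | x y. x \<in> {y. infnorm (y - a) \<le> r} \<and> y \<in> {y. infnorm (y - a) \<le> r}}"
  have le: "d \<le> 2 * r" if d: "d \<in> ?D" for d
  proof -
    obtain x y where "d = infnorm (x - y)" "infnorm (x - a) \<le> r" "infnorm (y - a) \<le> r"
      using d by auto
    then show ?thesis
      using infnorm_triangle[of "x - a" "a - y"] infnorm_sub[of a y] by simp
  qed
  have zero: "0 \<in> ?D"
    using assms by (intro CollectI exI[of _ a]) (simp add: infnorm_0)
  show "0 \<le> sup_diam {y. infnorm (y - a) \<le> r}"
    unfolding sup_diam_def by (rule cSup_upper[OF zero]) (use le in \<open>auto simp: bdd_above_def\<close>)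
  show "sup_diam {y. infnorm (y - a) \<le> r} \<le> 2 * r"
    unfolding sup_diam_def by (rule cSup_least) (use zero le in blast)+
qed

text \<open>
  A Borel--Cantelli argument: \<open>\<Lambda>\<close> is covered by the sets \<open>A n\<close> with \<open>n \<ge> N\<close>, and each
  nonempty \<open>A n\<close> lies in the ball of radius \<open>r n\<close> about any of its points.
\<close>

lemma hausdorff_pre_limsup_le:
  fixes \<Lambda> :: "(real ^ 'd::finite) set" and A :: "nat \<Rightarrow> (real ^ 'd) set"
  assumes s: "s > 0" and r: "\<And>n. r n > 0"
    and diam: "\<And>n x y. x \<in> A n \<Longrightarrow> y \<in> A n \<Longrightarrow> infnorm (x - y) \<le> r n"
    and sm: "summable (\<lambda>n. r n powr s)"
    and inf: "\<And>x N. x \<in> \<Lambda> \<Longrightarrow> \<exists>n\<ge>N. x \<in> A n"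
    and \<epsilon>: "\<epsilon> > 0" and \<delta>: "\<delta> > 0"
  shows "hausdorff_pre s \<epsilon> \<Lambda> \<le> ennreal \<delta>"
proof -
  define g where "g n = (2 * r n) powr s" for n
  have g: "summable g"
    unfolding g_def using sm r by (simp add: powr_mult summable_mult)
  (* A tail of the series below epsilon^s forces every single diameter in it below epsilon. *)
  have "min \<delta> (\<epsilon> powr s) > 0" using \<delta> \<epsilon> by simp
  from suminf_exist_split[OF this g] obtain N
    where "norm (\<Sum>i. g (i + N)) < min \<delta> (\<epsilon> powr s)" by blast
  then have N: "(\<Sum>i. g (i + N)) < min \<delta> (\<epsilon> powr s)"
    by (simp only: real_norm_def)
  have gN: "summable (\<lambda>i. g (i + N))" using g by (simp add: summable_iff_shift)
  have gnn: "g n \<ge> 0" for n by (simp add: g_def)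
  have partial: "(\<Sum>i\<in>F. g (i + N)) \<le> (\<Sum>i. g (i + N))" if "finite F" for F
    by (rule sum_le_suminf[OF gN that]) (simp add: gnn)
  have small: "2 * r (i + N) \<le> \<epsilon>" for i
  proof (rule ccontr)
    assume "\<not> 2 * r (i + N) \<le> \<epsilon>"
    then have "\<epsilon> powr s \<le> g (i + N)" unfolding g_def using s \<epsilon> by (intro powr_mono2) auto
    then show False using partial[of "{i}"] N by simp
  qed
  define J where "J = {i. A (i + N) \<noteq> {}}"
  define B where "B i = {y. infnorm (y - (SOME x. x \<in> A (i + N))) \<le> r (i + N)}" for i
  have diam_B: "0 \<le> sup_diam (B i)" "sup_diam (B i) \<le> 2 * r (i + N)" for i
    unfolding B_def using sup_diam_ball_bounds[OF r] by blast+
  have cover: "\<Lambda> \<subseteq> \<Union> (B ` J)"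
  proof
    fix x assume "x \<in> \<Lambda>"
    then obtain n where n: "n \<ge> N" "x \<in> A n" using inf by blast
    then obtain i where i: "x \<in> A (i + N)" by (metis le_add_diff_inverse2)
    then have "x \<in> B i" unfolding B_def using diam someI by fast
    then show "x \<in> \<Union> (B ` J)" using i by (auto simp: J_def)
  qed
  have "B ` J \<in> {R. countable R \<and> R \<subseteq> sup_balls \<and> (\<forall>B\<in>R. sup_diam B \<le> \<epsilon>) \<and> \<Lambda> \<subseteq> \<Union>R}"
  proof (intro CollectI conjI cover ballI)
    show "B ` J \<subseteq> sup_balls" using r by (auto simp: B_def sup_balls_def)
    show "sup_diam C \<le> \<epsilon>" if "C \<in> B ` J" for C
      using that diam_B(2) small by (auto intro: order_trans)
  qed auto
  then have "hausdorff_pre s \<epsilon> \<Lambda> \<le> (\<Sum>\<^sub>\<infinity>C\<in>B ` J. ennreal (sup_diam C powr s))"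
    unfolding hausdorff_pre_def by (rule INF_lower)
  also have "\<dots> \<le> ennreal \<delta>"
  proof (rule infsum_le_finite_sums)
    (* Different indices may give the same ball, so one index is chosen for each ball. *)
    fix F assume "finite F" "F \<subseteq> B ` J"
    then obtain K where K: "finite K" "inj_on B K" "F = B ` K"
      by (metis subset_image_inj finite_image_iff)
    have "(\<Sum>C\<in>F. ennreal (sup_diam C powr s)) = (\<Sum>i\<in>K. ennreal (sup_diam (B i) powr s))"
      by (simp add: K sum.reindex)
    also have "\<dots> \<le> (\<Sum>i\<in>K. ennreal (g (i + N)))"
      unfolding g_def using s diam_B by (intro sum_mono ennreal_leI powr_mono2) auto
    also have "\<dots> = ennreal (\<Sum>i\<in>K. g (i + N))" using gnn by simp
    also have "\<dots> \<le> ennreal \<delta>" using partial[OF K(1)] N by (intro ennreal_leI) linarith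
    finally show "(\<Sum>C\<in>F. ennreal (sup_diam C powr s)) \<le> ennreal \<delta>" .
  qed (simp add: nonneg_summable_on_complete)
  finally show ?thesis .
qed

lemma hausdorff_outer_measure_limsup_eq_0:
  fixes \<Lambda> :: "(real ^ 'd::finite) set" and A :: "nat \<Rightarrow> (real ^ 'd) set"
  assumes "s > 0" "\<And>n. r n > 0"
    and "\<And>n x y. x \<in> A n \<Longrightarrow> y \<in> A n \<Longrightarrow> infnorm (x - y) \<le> r n"
    and "summable (\<lambda>n. r n powr s)"
    and "\<And>x N. x \<in> \<Lambda> \<Longrightarrow> \<exists>n\<ge>N. x \<in> A n"
  shows "hausdorff_outer_measure s \<Lambda> = 0"
proof -
  have "hausdorff_pre s \<epsilon> \<Lambda> = 0" if "\<epsilon> > 0" for \<epsilon>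
  proof -
    have "hausdorff_pre s \<epsilon> \<Lambda> \<le> 0"
    proof (rule ennreal_le_epsilon)
      fix \<delta> :: real assume "\<delta> > 0"
      then show "hausdorff_pre s \<epsilon> \<Lambda> \<le> 0 + ennreal \<delta>"
        using hausdorff_pre_limsup_le[OF assms that] by simp
    qed
    then show ?thesis by simp
  qed
  then have "eventually (\<lambda>\<epsilon>. hausdorff_pre s \<epsilon> \<Lambda> = 0) (at_right 0)"
    using eventually_at_right_less[of "0::real"] by (auto elim: eventually_mono)
  then have "((\<lambda>\<epsilon>. hausdorff_pre s \<epsilon> \<Lambda>) \<longlongrightarrow> 0) (at_right 0)"
    by (rule tendsto_eventually)
  then show ?thesis
    unfolding hausdorff_outer_measure_def by (intro tendsto_Lim) simp_all
qed

section \<open>Orbits of weighted shifts and the dependence on the parameter\<close>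

lemma bshift_funpow: "(bshift w ^^ n) u m = (\<Prod>k=1..n. w (m + k)) * u (m + n)"
proof (induction n arbitrary: m)
  case (Suc n)
  have "(bshift w ^^ Suc n) u m = w (Suc m) * (bshift w ^^ n) u (Suc m)"
    by (simp add: bshift_def)
  also have "\<dots> = w (m + 1) * (\<Prod>k=1..n. w (m + Suc k)) * u (m + Suc n)"
    by (simp add: Suc.IH mult.assoc)
  also have "w (m + 1) * (\<Prod>k=1..n. w (m + Suc k)) = (\<Prod>k=1..Suc n. w (m + k))"
    by (simp add: prod.atLeast_Suc_atMost prod.shift_bounds_cl_Suc_ivl del: prod.cl_ivl_Suc)
  finally show ?case .
qed simp

lemma product_bshift_funpow:
  "(product_bshift w \<mu> ^^ n) u i = (bshift (w (\<mu> $ i)) ^^ n) (u i)"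
  by (induction n) (simp_all add: product_bshift_def)

lemma norm_bshift_funpow_first:
  assumes "\<And>k. k \<ge> 1 \<Longrightarrow> w k \<noteq> 0"
  shows "norm ((bshift w ^^ n) u 0) = exp (\<Sum>k=1..n. ln (norm (w k))) * norm (u n)"
proof -
  have "exp (\<Sum>k=1..n. ln (norm (w k))) = (\<Prod>k=1..n. norm (w k))"
    unfolding exp_sum[OF finite_atLeastAtMost] using assms by (intro prod.cong) auto
  then show ?thesis by (simp add: bshift_funpow norm_mult prod_norm)
qed

text \<open>
  Two positive numbers between 1/2 and 3/2 have a ratio below 3, which is \<open>exp (a - b)\<close> here.
\<close>

lemma abs_diff_less_ln3:
  fixes a b t :: real
  assumes "1 / 2 < exp a * t" "exp a * t < 3 / 2" "1 / 2 < exp b * t" "exp b * t < 3 / 2"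
  shows "\<bar>a - b\<bar> < ln 3"
proof -
  have t: "t > 0" using assms(1) by (smt (verit) exp_gt_zero mult_nonneg_nonpos divide_pos_pos)
  have "exp a * t < (3 * exp b) * t" "exp b * t < (3 * exp a) * t" using assms by linarith+
  then have "exp a < exp (ln 3 + b)" "exp b < exp (ln 3 + a)"
    using t by (simp_all add: exp_add)
  then show ?thesis by simp
qed

theorem theorem3p1:
  fixes X :: "(nat \<Rightarrow> 'a::real_normed_field) set"
    and nrm :: "(nat \<Rightarrow> 'a) \<Rightarrow> real"
    and I :: "real set"
    and w :: "real \<Rightarrow> nat \<Rightarrow> 'a"
    and f :: "nat \<Rightarrow> real \<Rightarrow> real"
    and F :: "nat \<Rightarrow> real"
    and c s :: real
    and \<Lambda> :: "(real ^ 'd::finite) set"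
  assumes "(X = c0_space \<and> nrm = c0_norm) \<or> (\<exists>p\<ge>1. X = lp_space p \<and> nrm = lp_norm p)"
    and "admissible_family X nrm I w"
    and "\<And>n x. f n x = (\<Sum>k=1..n. ln (norm (w x k)))"
    and "\<And>n. n \<ge> 1 \<Longrightarrow> F n > 0"
    and "c > 0"
    and "\<And>x y n. x \<in> I \<Longrightarrow> y \<in> I \<Longrightarrow> n \<ge> 1 \<Longrightarrow> \<bar>f n x - f n y\<bar> \<ge> c * F n * \<bar>x - y\<bar>"
    and "s > 0"
    and "(\<lambda>n. 1 / F n powr s) summable_on {1..}"
    and "\<Lambda> \<subseteq> {\<mu>. \<forall>i. \<mu> $ i \<in> I}"
    and "hausdorff_outer_measure s \<Lambda> > 0"
  shows "(\<Inter>\<mu>\<in>\<Lambda>. HC (power_topology (seq_topology X nrm)) (product_bshift w \<mu>)) = {}"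
proof (rule equals0I)
  fix u assume u: "u \<in> (\<Inter>\<mu>\<in>\<Lambda>. HC (power_topology (seq_topology X nrm)) (product_bshift w \<mu>))"
  interpret coordinatewise_normed_space X nrm
    using assms(1) coordinatewise_normed_space_c0 coordinatewise_normed_space_lp by blast
  (* F 0 is arbitrary, so the n-th set of the covering family belongs to time n + 1. *)
  define A where "A n = {\<mu> \<in> \<Lambda>. \<forall>i. norm ((product_bshift w \<mu> ^^ Suc n) u i 0 - 1) < 1 / 2}" for n
  define r where "r n = ln 3 / (c * F (Suc n))" for n
  have rpos: "r n > 0" for n using assms(4)[of "Suc n"] assms(5) by (simp add: r_def)
  have first: "norm ((product_bshift w \<mu> ^^ n) u i 0) = exp (f n (\<mu> $ i)) * norm (u i n)"
    if "\<mu> \<in> \<Lambda>" for \<mu> n i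
  proof -
    have "\<mu> $ i \<in> I" using that assms(9) by blast
    then have "w (\<mu> $ i) k \<noteq> 0" if "k \<ge> 1" for k
      using assms(2) that by (simp add: admissible_family_def admissible_weight_def)
    then show ?thesis
      by (simp add: product_bshift_funpow norm_bshift_funpow_first assms(3))
  qed
  have first_bounds: "1 / 2 < exp (f (Suc n) (\<mu> $ i)) * norm (u i (Suc n))"
      "exp (f (Suc n) (\<mu> $ i)) * norm (u i (Suc n)) < 3 / 2"
    if "\<mu> \<in> A n" for \<mu> n i
  proof -
    have \<mu>: "\<mu> \<in> \<Lambda>" and near: "norm ((product_bshift w \<mu> ^^ Suc n) u i 0 - 1) < 1 / 2"
      using that unfolding A_def by blast+
    have "\<bar>norm ((product_bshift w \<mu> ^^ Suc n) u i 0) - norm (1::'a)\<bar> < 1 / 2"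
      using norm_triangle_ineq3 near by (rule le_less_trans)
    then show "1 / 2 < exp (f (Suc n) (\<mu> $ i)) * norm (u i (Suc n))"
      "exp (f (Suc n) (\<mu> $ i)) * norm (u i (Suc n)) < 3 / 2"
      unfolding first[OF \<mu>] norm_one by linarith+
  qed
  have "hausdorff_outer_measure s \<Lambda> = 0"
  proof (rule hausdorff_outer_measure_limsup_eq_0[where A = A and r = r])
    fix n and x y :: "real ^ 'd" assume xy: "x \<in> A n" "y \<in> A n"
    have "\<bar>(x - y) $ i\<bar> \<le> r n" for i
    proof -
      have "x $ i \<in> I" "y $ i \<in> I" using xy assms(9) by (auto simp: A_def)
      then have "c * F (Suc n) * \<bar>x $ i - y $ i\<bar> \<le> \<bar>f (Suc n) (x $ i) - f (Suc n) (y $ i)\<bar>"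
        by (intro assms(6)) simp_all
      also have "\<dots> < ln 3"
        by (rule abs_diff_less_ln3) (rule first_bounds[OF xy(1)] first_bounds[OF xy(2)])+
      finally show ?thesis
        using assms(4)[of "Suc n"] assms(5) by (simp add: r_def field_simps)
    qed
    then show "infnorm (x - y) \<le> r n"
      unfolding infnorm_cart by (intro cSup_least) auto
  next
    have "(\<lambda>n. 1 / F n powr s) summable_on (Suc ` UNIV)"
      using assms(8) by (simp add: atLeast_Suc_greaterThan greaterThan_0)
    then have "summable (\<lambda>n. 1 / F (Suc n) powr s)"
      by (simp add: summable_on_reindex o_def summable_on_imp_summable)
    then have "summable (\<lambda>n. (ln 3 / c) powr s * (1 / F (Suc n) powr s))"
      by (rule summable_mult)
    moreover have "r n powr s = (ln 3 / c) powr s * (1 / F (Suc n) powr s)" for n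
      using assms(4)[of "Suc n"] assms(5) by (simp add: r_def powr_divide powr_mult)
    ultimately show "summable (\<lambda>n. r n powr s)" by simp
  next
    fix x N assume x: "x \<in> \<Lambda>"
    then have "u \<in> HC (power_topology (seq_topology X nrm)) (product_bshift w x)" using u by blast
    from HC_visits_infinitely_often[OF this, of "Suc N"] obtain n
      where "n \<ge> Suc N" "\<forall>i. norm ((product_bshift w x ^^ n) u i 0 - 1) < 1 / 2" by blast
    then show "\<exists>n\<ge>N. x \<in> A n"
      using x unfolding A_def by (intro exI[of _ "n - 1"]) auto
  qed (use assms(7) rpos in auto)
  then show False using assms(10) by simp
qed

end
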